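(* Let $K = 2^{2L}$ with $L$ a positive integer, and let $\{p_i\}_{1\le i\le N}\subset\mathbb{R}^3$ be points with $|p_i|\le K/2$ for all $i$. Let $B$ be a box of width $w$ in the octree associated with these points, and let $N^B$ be its (high-frequency) near field. If $w \ge 2\sqrt{K}$, then $N^B$ contains all nonempty boxes in the octree.
   Context: $|\cdot|$ is the Euclidean norm. The octree is built on the cube of width $K$ centered at the origin: its level-$l$ boxes form a $2^l\times 2^l\times 2^l$ grid of cubes of width $K\cdot 2^{-l}$, and each box that is subdivided is split into its 8 children of half the width. A box is nonempty if it contains at least one of the points $p_i$. A box is in the high-frequency regime if its width is at least $1$; there, every nonempty box is subdivided (in the low-frequency regime, width less than $1$, a box is subdivided exactly when it contains more than a fixed constant number of points). For a box $B$ with center $c$ and width $w\ge 1$, the near field $N^B$ is the collection of boxes $A$ of the octree that contain a point $x$ with $|x-c|\le 3w^2/4$. *)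

theory Defs
  imports "HOL-Analysis.Analysis"
begin

datatype box = Box (center: "real^3") (width: real)

text \<open>Boxes are closed cubes, so that the cubes of each level cover the whole root cube,
  including its outer faces; a point on a common face lies in every box meeting there.\<close>

definition region :: "box \<Rightarrow> (real^3) set" where
  "region B = {x. \<forall>k. \<bar>x $ k - center B $ k\<bar> \<le> width B / 2}"

definition children :: "box \<Rightarrow> box set" where
  "children B = {A. width A = width B / 2 \<and>
     (\<forall>k. \<bar>center A $ k - center B $ k\<bar> = width B / 4)}"

text \<open>The points are \<open>p 1, \<dots>, p N\<close>, counted with multiplicity.\<close>

definition points_in :: "(nat \<Rightarrow> real^3) \<Rightarrow> nat \<Rightarrow> box \<Rightarrow> nat set" where
  "points_in p N B = {i \<in> {1..N}. p i \<in> region B}"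

definition nonempty_box :: "(nat \<Rightarrow> real^3) \<Rightarrow> nat \<Rightarrow> box \<Rightarrow> bool" where
  "nonempty_box p N B \<longleftrightarrow> points_in p N B \<noteq> {}"

definition high_frequency :: "box \<Rightarrow> bool" where
  "high_frequency B \<longleftrightarrow> width B \<ge> 1"

text \<open>\<open>m\<close> is the constant that limits the number of points in a low-frequency leaf.\<close>

definition subdivided :: "(nat \<Rightarrow> real^3) \<Rightarrow> nat \<Rightarrow> nat \<Rightarrow> box \<Rightarrow> bool" where
  "subdivided p N m B \<longleftrightarrow>
     (if high_frequency B then nonempty_box p N B else card (points_in p N B) > m)"

inductive_set octree :: "real \<Rightarrow> (nat \<Rightarrow> real^3) \<Rightarrow> nat \<Rightarrow> nat \<Rightarrow> box set"
  for K :: real and p :: "nat \<Rightarrow> real^3" and N m :: nat where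
  root: "Box 0 K \<in> octree K p N m"
| child: "\<lbrakk>B \<in> octree K p N m; subdivided p N m B; A \<in> children B\<rbrakk> \<Longrightarrow> A \<in> octree K p N m"

text \<open>The boxes at depth \<open>l\<close> belong to the \<open>2^l \<times> 2^l \<times> 2^l\<close> grid of cubes of width \<open>K / 2^l\<close>.\<close>

lemma octree_in_grid:
  assumes "B \<in> octree K p N m"
  shows "\<exists>l. width B = K / 2 ^ l \<and>
    (\<forall>k. \<exists>j::nat. j < 2 ^ l \<and> center B $ k = - K / 2 + (real j + 1 / 2) * (K / 2 ^ l))"
  using assms
proof induction
  case root
  show ?case by (rule exI[of _ 0]) auto
next
  case (child B A)
  then obtain l where w: "width B = K / 2 ^ l" and
    c: "\<And>k. \<exists>j::nat. j < 2 ^ l \<and> center B $ k = - K / 2 + (real j + 1 / 2) * (K / 2 ^ l)"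
    by blast
  have wA: "width A = K / 2 ^ Suc l"
    using child.hyps w by (simp add: children_def)
  have "\<exists>j::nat. j < 2 ^ Suc l \<and>
      center A $ k = - K / 2 + (real j + 1 / 2) * (K / 2 ^ Suc l)" for k
  proof -
    obtain j :: nat where j: "j < 2 ^ l"
      "center B $ k = - K / 2 + (real j + 1 / 2) * (K / 2 ^ l)" using c by blast
    define d where "d = K / 2 ^ Suc l"
    have d2: "K / 2 ^ l = 2 * d" by (simp add: d_def)
    have "\<bar>center A $ k - center B $ k\<bar> = d / 2"
      using child.hyps w d2 by (simp add: children_def)
    then have "center A $ k = center B $ k + d / 2 \<or> center A $ k = center B $ k - d / 2"
      by linarith
    then show ?thesis
    proof
      assume "center A $ k = center B $ k + d / 2"
      then have "center A $ k = - K / 2 + (real (2 * j + 1) + 1 / 2) * d"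
        using j(2) unfolding d2 by (simp add: algebra_simps)
      with j(1) show ?thesis by (intro exI[of _ "2 * j + 1"]) (auto simp: d_def)
    next
      assume "center A $ k = center B $ k - d / 2"
      then have "center A $ k = - K / 2 + (real (2 * j) + 1 / 2) * d"
        using j(2) unfolding d2 by (simp add: algebra_simps)
      with j(1) show ?thesis by (intro exI[of _ "2 * j"]) (auto simp: d_def)
    qed
  qed
  with wA show ?case by blast
qed

text \<open>The high-frequency near field, used only for boxes of width at least 1. The witness \<open>x\<close>
  is any point of space in \<open>A\<close>, not necessarily one of the given points.\<close>

definition near_field :: "real \<Rightarrow> (nat \<Rightarrow> real^3) \<Rightarrow> nat \<Rightarrow> nat \<Rightarrow> box \<Rightarrow> box set" where
  "near_field K p N m B =
     {A \<in> octree K p N m. \<exists>x \<in> region A. norm (x - center B) \<le> 3 * (width B)^2 / 4}"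

end

theory Submission
  imports Defs
begin

text \<open>Once \<open>w \<ge> 2 * sqrt K\<close>, the near-field radius \<open>3 * w\<^sup>2 / 4\<close> is at least \<open>3 * K\<close>, while everything
  relevant happens within distance \<open>2 * K\<close>: the center \<open>c\<close> of any box lies in the root cube, so
  \<open>norm c \<le> 3 * K / 2\<close>, and the given points lie in the ball of radius \<open>K / 2\<close> around the origin.
  Hence a given point in a nonempty box already witnesses that this box is in the near field. The
  estimate is crude enough that the norm of \<open>c\<close> may be replaced by the sum of its coordinates.\<close>

lemma octree_center_in_root:
  assumes "B \<in> octree K p N m" and "K \<ge> 0"
  shows "center B \<in> region (Box 0 K)"
proof -
  have "\<bar>center B $ k\<bar> \<le> K / 2" for k
  proof -
    obtain l and j :: nat where "j < 2 ^ l"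
      and c: "center B $ k = - K / 2 + (real j + 1 / 2) * (K / 2 ^ l)"
      using octree_in_grid[OF assms(1)] by blast
    define d where "d = K / 2 ^ l"
    have "d \<ge> 0" and K: "K = 2 ^ l * d" using assms(2) by (simp_all add: d_def)
    have "real (Suc j) \<le> real (2 ^ l)"
      using \<open>j < 2 ^ l\<close> by (intro of_nat_mono) simp
    then have "real j + 1 / 2 \<le> 2 ^ l" by simp
    then have "(real j + 1 / 2) * d \<le> K"
      unfolding K using \<open>d \<ge> 0\<close> by (rule mult_right_mono)
    moreover have "(real j + 1 / 2) * d \<ge> 0" using \<open>d \<ge> 0\<close> by simp
    ultimately show ?thesis using c unfolding d_def[symmetric] by linarith
  qed
  then show ?thesis by (simp add: region_def)
qed

lemma norm_le_of_in_origin_cube: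
  assumes "x \<in> region (Box 0 K)"
  shows "norm x \<le> 3 * K / 2"
proof -
  have "norm x \<le> (\<Sum>k\<in>UNIV. \<bar>x $ k\<bar>)" by (rule norm_le_l1_cart)
  also have "\<dots> \<le> (\<Sum>k\<in>(UNIV :: 3 set). K / 2)"
    using assms by (intro sum_mono) (simp add: region_def)
  finally show ?thesis by simp
qed

theorem proposition2p1:
  fixes L N m :: nat and K w :: real and p :: "nat \<Rightarrow> real^3" and B :: box
  assumes "L \<ge> 1"
    and "K = 2 ^ (2 * L)"
    and "\<And>i. i \<in> {1..N} \<Longrightarrow> norm (p i) \<le> K / 2"
    and "B \<in> octree K p N m"
    and "width B = w"
    and "w \<ge> 2 * sqrt K"
  shows "{A \<in> octree K p N m. nonempty_box p N A} \<subseteq> near_field K p N m B"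
proof
  fix A assume "A \<in> {A \<in> octree K p N m. nonempty_box p N A}"
  then obtain i where A: "A \<in> octree K p N m" and i: "i \<in> {1..N}" "p i \<in> region A"
    by (auto simp: nonempty_box_def points_in_def)
  have "K \<ge> 0" using assms(2) by simp
  have "(2 * sqrt K)\<^sup>2 \<le> w\<^sup>2"
    using assms(6) \<open>K \<ge> 0\<close> by (intro power_mono) simp_all
  then have radius: "3 * K \<le> 3 * w\<^sup>2 / 4"
    using \<open>K \<ge> 0\<close> by (simp add: power_mult_distrib)
  have "norm (p i - center B) \<le> norm (p i) + norm (center B)"
    by (rule norm_triangle_ineq4)
  also have "\<dots> \<le> K / 2 + 3 * K / 2"
    using assms(3)[OF i(1)]
      norm_le_of_in_origin_cube[OF octree_center_in_root[OF assms(4) \<open>K \<ge> 0\<close>]]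
    by (rule add_mono)
  also have "\<dots> \<le> 3 * (width B)\<^sup>2 / 4"
    using radius \<open>K \<ge> 0\<close> assms(5) by simp
  finally show "A \<in> near_field K p N m B"
    using A i(2) by (auto simp: near_field_def)
qed

end
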